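(* There exists an absolute constant $A>0$ such that for all integers $k,\ell\geq 1$ the following three estimates hold: \[ \left|P_{k,\ell} - e^{-k}\sum_{\nu=0}^{k-1}\frac{k^\nu}{\nu!}\right|\leq A\,\frac{k^2}{\ell}, \] \[ \left|P_{k,\ell} - \left(1-e^{-\ell}\sum_{\nu=0}^{\ell}\frac{\ell^\nu}{\nu!}\right)\right|\leq A\,\frac{\ell^2}{k}, \] and \[ \left|P_{k,\ell}-\frac{1}{2}\right|\leq \frac{A}{\sqrt{\min(k,\ell)}}. \]
   Context: For integers $k,\ell\geq 1$ define \[ P_{k,\ell} = \frac{(k+\ell)!}{(k-1)!\,\ell!}\int_{k/(k+\ell)}^1 t^{k-1}(1-t)^\ell\,dt. \] *)

theory Defs
  imports "HOL-Analysis.Analysis"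
begin

definition P :: "nat \<Rightarrow> nat \<Rightarrow> real" where
  "P k l = fact (k + l) / (fact (k - 1) * fact l) *
     integral {real k / real (k + l)..1} (\<lambda>t::real. t ^ (k - 1) * (1 - t) ^ l)"

end

theory Submission
  imports Defs
begin

text \<open>
  Integrating the derivative of the binomial distribution function in its success parameter
  identifies \<open>P k l\<close> with the probability that a binomial variable with \<open>n = k + l\<close> trials
  and mean \<open>k\<close> is less than \<open>k\<close>.

  The first two estimates are Poisson approximation with error \<open>n p\<^sup>2\<close>, applied to the successes
  (\<open>p = k / n\<close>) and to the failures (\<open>p = l / n\<close>). The Poisson distribution function \<open>G\<^sub>k(x)\<close>
  satisfies \<open>G\<^sub>k' = - (G\<^sub>k - G\<^sub>k\<^sub>-\<^sub>1)\<close>, so replacing the mean \<open>x\<close> by \<open>x + p\<close> agrees up to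
  \<open>p\<^sup>2\<close> with adding one Bernoulli trial, and these errors add up over the \<open>n\<close> trials.

  For the third, the mean \<open>k\<close> is a median: \<open>P k l \<le> 1/2\<close> and \<open>P l k \<le> 1/2\<close>, while
  \<open>P k l + P l k\<close> falls short of 1 by the probability of the value \<open>k\<close>. That central probability
  is decreasing in \<open>k\<close> and in \<open>l\<close>, hence at most the central binomial probability with
  \<open>2 min(k,l)\<close> trials. The median property comes from comparing the beta density at
  points reflected about \<open>k / n\<close>, in the coordinate \<open>t\<close> if \<open>k > l\<close> and in the logarithm of
  the odds \<open>t / (1 - t)\<close> if \<open>k \<le> l\<close>; in either case the part above \<open>k / n\<close> is reflected into \<open>[0, k / n]\<close>.
\<close>

section \<open>Binomial distribution function and its integral form\<close>

text \<open>Despite the name this is a lower tail. The strict bound \<open>i < k\<close> matches the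
  event behind \<open>P k l\<close> and makes \<open>k = 0\<close> an empty sum, the base case of
  the recursions in \<open>k\<close>.\<close>

definition binomial_tail :: "nat \<Rightarrow> nat \<Rightarrow> real \<Rightarrow> real" where
  "binomial_tail n k x = (\<Sum>i<k. Bernstein n i x)"

definition poisson_tail :: "nat \<Rightarrow> real \<Rightarrow> real" where
  "poisson_tail k x = exp (- x) * (\<Sum>i<k. x ^ i / fact i)"

text \<open>Condition on the last trial. Since \<open>n - i\<close> truncates, the indices
  \<open>i = n\<close> and \<open>n < i\<close> are treated apart.\<close>

lemma Bernstein_Suc_Suc:
  "Bernstein (Suc n) (Suc i) x = (1 - x) * Bernstein n (Suc i) x + x * Bernstein n i x"
proof (cases "i < n")
  case True
  then have "n - i = Suc (n - Suc i)" by simp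
  then show ?thesis by (simp add: Bernstein_def algebra_simps)
next
  case False
  then consider "i = n" | "n < i" by linarith
  then show ?thesis by cases (simp_all add: Bernstein_def binomial_eq_0)
qed

lemma Bernstein_reflect: "i \<le> n \<Longrightarrow> Bernstein n (n - i) (1 - x) = Bernstein n i x"
  by (simp add: Bernstein_def binomial_symmetric[of i n])

lemma Bernstein_eq_0: "n < i \<Longrightarrow> Bernstein n i x = 0"
  by (simp add: Bernstein_def)

lemma binomial_tail_Suc_Suc:
  "binomial_tail (Suc n) (Suc k) x = (1 - x) * binomial_tail n (Suc k) x + x * binomial_tail n k x"
proof -
  have "binomial_tail (Suc n) (Suc k) x
      = Bernstein (Suc n) 0 x + (\<Sum>i<k. Bernstein (Suc n) (Suc i) x)"
    unfolding binomial_tail_def by (rule sum.lessThan_Suc_shift)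
  also have "\<dots> = (1 - x) * (Bernstein n 0 x + (\<Sum>i<k. Bernstein n (Suc i) x))
      + x * (\<Sum>i<k. Bernstein n i x)"
    by (simp add: Bernstein_Suc_Suc sum.distrib sum_distrib_left distrib_left)
       (simp add: Bernstein_def)
  also have "Bernstein n 0 x + (\<Sum>i<k. Bernstein n (Suc i) x) = binomial_tail n (Suc k) x"
    unfolding binomial_tail_def by (rule sum.lessThan_Suc_shift[symmetric])
  finally show ?thesis by (simp add: binomial_tail_def)
qed

lemma binomial_tail_0 [simp]: "binomial_tail n 0 x = 0"
  by (simp add: binomial_tail_def)

lemma binomial_tail_total: "n < k \<Longrightarrow> binomial_tail n k x = 1"
proof -
  assume "n < k"
  then have "binomial_tail n k x = (\<Sum>i\<le>n. Bernstein n i x)"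
    unfolding binomial_tail_def
    by (intro sum.mono_neutral_right) (auto simp: Bernstein_eq_0)
  then show ?thesis by simp
qed

lemma binomial_tail_le_1:
  assumes "0 \<le> x" "x \<le> 1"
  shows "binomial_tail n k x \<le> 1"
proof -
  have "binomial_tail n k x \<le> binomial_tail n (k + Suc n) x"
    unfolding binomial_tail_def using assms
    by (intro sum_mono2) (auto intro: Bernstein_nonneg)
  then show ?thesis by (simp add: binomial_tail_total)
qed

lemma binomial_tail_at_1: "k \<le> n \<Longrightarrow> binomial_tail n k 1 = 0"
  by (auto simp: binomial_tail_def Bernstein_def intro!: sum.neutral)

text \<open>Interchange successes and failures: with \<open>n = k + l\<close> trials, at most
  \<open>l\<close> failures means at least \<open>k\<close> successes, the complement of fewer than
  \<open>k\<close> successes.\<close>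

lemma binomial_tail_reflect:
  assumes "k + l = n"
  shows "binomial_tail n k x + binomial_tail n (Suc l) (1 - x) = 1"
proof -
  have "(\<Sum>i<Suc l. Bernstein n i (1 - x)) = (\<Sum>i\<in>{k..n}. Bernstein n i x)"
    using assms
    by (intro sum.reindex_bij_witness[of _ "\<lambda>i. n - i" "\<lambda>i. n - i"])
       (auto simp flip: Bernstein_reflect[of _ n "1 - x"])
  moreover have "(\<Sum>i<k. Bernstein n i x) + (\<Sum>i\<in>{k..n}. Bernstein n i x)
      = (\<Sum>i<Suc n. Bernstein n i x)"
    using sum.atLeastLessThan_concat[of 0 k "Suc n" "\<lambda>i. Bernstein n i x"] assms
    by (simp add: atLeastLessThanSuc_atLeastAtMost atLeast0LessThan atLeast0AtMost lessThan_Suc_atMost del: sum.lessThan_Suc)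
  ultimately show ?thesis
    using binomial_tail_total[of n "Suc n" x] by (simp add: binomial_tail_def)
qed

text \<open>Each weight has derivative \<open>e i - e (Suc i)\<close>, so the sum telescopes to
  \<open>- e k\<close>, because \<open>e 0 = 0\<close>. What remains is minus the normalised beta
  density in \<open>P k l\<close>.\<close>

lemma has_field_derivative_binomial_tail:
  assumes "k + l = n" "k \<ge> 1"
  shows "(binomial_tail n k has_real_derivative
    - (fact n / (fact (k - 1) * fact l) * (x ^ (k - 1) * (1 - x) ^ l))) (at x within S)"
proof -
  define e where "e i = real i * real (n choose i) * x ^ (i - 1) * (1 - x) ^ (n - i)" for i
  have D: "((\<lambda>x. Bernstein n i x) has_real_derivative e i - e (Suc i)) (at x within S)"
    if "i < n" for i
  proof -
    have ch: "real (Suc i) * real (n choose Suc i) = real (n - i) * real (n choose i)"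
      using binomial_absorb_comp[of n i] binomial_absorption[of i n]
      by (metis mult.commute of_nat_mult)
    show ?thesis
      unfolding Bernstein_def e_def ch
      by (auto intro!: derivative_eq_intros simp: algebra_simps)
  qed
  have "(binomial_tail n k has_real_derivative (\<Sum>i<k. e i - e (Suc i))) (at x within S)"
    unfolding binomial_tail_def[abs_def] by (intro DERIV_sum D) (use assms in auto)
  moreover have "(\<Sum>i<k. e i - e (Suc i)) = - e k"
    unfolding sum_lessThan_telescope' by (simp add: e_def)
  moreover have "n - k = l" using assms by simp
  then have "real k * real (n choose k) = fact n / (fact (k - 1) * fact l)"
    using assms by (simp add: binomial_fact fact_reduce[of k])
  ultimately show ?thesis
    using assms by (auto simp: e_def mult.assoc)
qed

lemma P_eq_binomial_tail:
  assumes "k \<ge> 1" "l \<ge> 1"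
  shows "P k l = binomial_tail (k + l) k (real k / real (k + l))"
proof -
  define p where "p = real k / real (k + l)"
  define c :: real where "c = fact (k + l) / (fact (k - 1) * fact l)"
  have "p \<le> 1" using assms by (simp add: p_def)
  have "((\<lambda>t. - (c * (t ^ (k - 1) * (1 - t) ^ l))) has_integral
      binomial_tail (k + l) k 1 - binomial_tail (k + l) k p) {p..1}"
    using \<open>p \<le> 1\<close> has_field_derivative_binomial_tail[OF refl assms(1), of l]
    by (intro fundamental_theorem_of_calculus)
       (auto simp: c_def simp flip: has_real_derivative_iff_has_vector_derivative)
  moreover have "binomial_tail (k + l) k 1 = 0"
    by (simp add: binomial_tail_at_1)
  ultimately have "((\<lambda>t. - (c * (t ^ (k - 1) * (1 - t) ^ l))) has_integral
      - binomial_tail (k + l) k p) {p..1}"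
    by simp
  from has_integral_neg[OF this] have "((\<lambda>t. c * (t ^ (k - 1) * (1 - t) ^ l)) has_integral
      binomial_tail (k + l) k p) {p..1}"
    by simp
  then have "integral {p..1} (\<lambda>t. c * (t ^ (k - 1) * (1 - t) ^ l)) = binomial_tail (k + l) k p"
    by (rule integral_unique)
  then show ?thesis by (simp add: P_def p_def c_def)
qed

section \<open>Poisson approximation with error \<open>n * p^2\<close>\<close>

text \<open>For \<open>x \<ge> 0\<close> the exponential series has nonnegative terms, so no single
  term exceeds \<open>exp x\<close>.\<close>

lemma poisson_weight_le_1: "0 \<le> x \<Longrightarrow> exp (- x) * x ^ i / fact i \<le> (1 :: real)"
proof -
  assume x: "0 \<le> x"
  have "x ^ i / fact i \<le> (\<Sum>j<Suc i. x ^ j / fact j)"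
    using x by (simp add: sum_nonneg)
  also have "\<dots> \<le> exp x"
    unfolding exp_def
    using x summable_exp_generic[of x]
    by (intro order.trans[OF sum_le_suminf]) (auto simp: field_simps scaleR_conv_of_real)
  finally show ?thesis
    by (simp add: exp_minus field_simps)
qed

lemma has_field_derivative_poisson_weight:
  "((\<lambda>x. exp (- x) * x ^ Suc i / fact (Suc i)) has_real_derivative
    exp (- x) * x ^ i / fact i - exp (- x) * x ^ Suc i / fact (Suc i)) (at x within S)"
proof -
  have "((\<lambda>x. x ^ Suc i / fact (Suc i)) has_real_derivative x ^ i / fact i) (at x within S)"
    by (rule derivative_eq_intros refl | simp)+
  moreover have "((\<lambda>x. exp (- x)) has_real_derivative - exp (- x)) (at x within S)"
    by (auto intro!: derivative_eq_intros)
  ultimately have "((\<lambda>x. exp (- x) * (x ^ Suc i / fact (Suc i))) has_real_derivative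
      - exp (- x) * (x ^ Suc i / fact (Suc i)) + x ^ i / fact i * exp (- x)) (at x within S)"
    by (rule DERIV_mult[rotated])
  moreover have "- exp (- x) * (x ^ Suc i / fact (Suc i)) + x ^ i / fact i * exp (- x)
      = exp (- x) * x ^ i / fact i - exp (- x) * x ^ Suc i / fact (Suc i)"
    by (simp del: fact_Suc)
  ultimately show ?thesis by (simp only: times_divide_eq_right)
qed

lemma has_field_derivative_poisson_tail:
  "(poisson_tail (Suc k) has_real_derivative - (exp (- x) * x ^ k / fact k)) (at x within S)"
proof (induction k)
  case 0
  show ?case
    unfolding poisson_tail_def by (auto intro!: derivative_eq_intros)
next
  case (Suc k)
  have "poisson_tail (Suc (Suc k)) = (\<lambda>x. poisson_tail (Suc k) x + exp (- x) * x ^ Suc k / fact (Suc k))"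
    unfolding poisson_tail_def sum.lessThan_Suc[of _ "Suc k"] by (simp add: fun_eq_iff distrib_left)
  then show ?case
    using DERIV_add[OF Suc has_field_derivative_poisson_weight[of k x S]] by simp
qed

text \<open>The derivative of a weight is a difference of two weights in [0, 1], or
  \<open>- exp (- z)\<close> when \<open>i = 0\<close>. Its modulus is at most 1, and the mean value
  theorem applies.\<close>

lemma poisson_weight_lipschitz:
  assumes "0 \<le> x" "x \<le> y"
  shows "\<bar>exp (- y) * y ^ i / fact i - exp (- x) * x ^ i / fact i\<bar> \<le> y - (x :: real)"
proof (cases "x = y")
  case False
  with assms have "x < y" by simp
  obtain z d where z: "x < z" "z < y"
    and eq: "exp (- y) * y ^ i / fact i - exp (- x) * x ^ i / fact i = (y - x) * d" and d: "\<bar>d\<bar> \<le> 1"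
  proof (cases i)
    case 0
    obtain z where "z > x" "z < y" "exp (- y) - exp (- x) = (y - x) * (- exp (- z))"
      using MVT2[OF \<open>x < y\<close>, of "\<lambda>x. exp (- x)" "\<lambda>x. - exp (- x)"]
        DERIV_fun_exp[OF DERIV_minus[OF DERIV_ident]] by auto
    with 0 show ?thesis using assms that[of z "- exp (- z)"] by simp
  next
    case (Suc j)
    let ?w = "\<lambda>i z. exp (- z) * z ^ i / fact i :: real"
    obtain z where z: "z > x" "z < y" "?w i y - ?w i x = (y - x) * (?w j z - ?w i z)"
      using MVT2[OF \<open>x < y\<close>, of "?w i" "\<lambda>z. ?w j z - ?w i z"]
        has_field_derivative_poisson_weight Suc by blast
    have "?w j z \<ge> 0" "?w i z \<ge> 0" "?w j z \<le> 1" "?w i z \<le> 1"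
      using z assms poisson_weight_le_1 by auto
    then have "\<bar>?w j z - ?w i z\<bar> \<le> 1" by linarith
    with z that show ?thesis by blast
  qed
  show ?thesis
    unfolding eq using \<open>x < y\<close> d by (simp add: abs_mult mult_left_le)
qed simp

text \<open>The convex combination equals \<open>poisson_tail (Suc k) x - h * w x\<close>, the
  first-order expansion of the tail at \<open>x\<close>. The mean value theorem replaces
  \<open>w x\<close> by \<open>w z\<close> with \<open>z\<close> within \<open>h\<close> of
  \<open>x\<close>, and the Lipschitz bound makes the error at most \<open>h * h\<close>.\<close>

lemma poisson_tail_step:
  assumes "0 \<le> x" "0 \<le> h"
  shows "\<bar>(1 - h) * poisson_tail (Suc k) x + h * poisson_tail k x - poisson_tail (Suc k) (x + h)\<bar> \<le> h\<^sup>2"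
proof (cases "h = 0")
  case False
  with assms have "0 < h" by simp
  define w where "w z = exp (- z) * z ^ k / fact k" for z :: real
  have lin: "(1 - h) * poisson_tail (Suc k) x + h * poisson_tail k x = poisson_tail (Suc k) x - h * w x"
    by (simp add: poisson_tail_def w_def algebra_simps add_divide_distrib diff_divide_distrib)
  obtain z where z: "x < z" "z < x + h"
    and eq: "poisson_tail (Suc k) (x + h) - poisson_tail (Suc k) x = h * (- w z)"
    using MVT2[of x "x + h" "poisson_tail (Suc k)" "\<lambda>z. - w z"] \<open>0 < h\<close>
      has_field_derivative_poisson_tail unfolding w_def by auto
  have "\<bar>w z - w x\<bar> \<le> h"
    using poisson_weight_lipschitz[of x z k] z assms unfolding w_def by linarith
  moreover have "poisson_tail (Suc k) x - h * w x - poisson_tail (Suc k) (x + h) = h * (w z - w x)"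
    using eq by (simp add: algebra_simps)
  ultimately show ?thesis
    unfolding lin using \<open>0 < h\<close> by (simp add: abs_mult power2_eq_square)
qed (simp add: poisson_tail_def algebra_simps)

text \<open>Induction on the number of trials: conditioning on the new trial averages the old
  errors, each at most \<open>n * p^2\<close>, and \<open>poisson_tail_step\<close> adds one more
  \<open>p^2\<close>.\<close>

lemma binomial_tail_poisson:
  assumes "0 \<le> p" "p \<le> 1"
  shows "\<bar>binomial_tail n k p - poisson_tail k (n * p)\<bar> \<le> n * p\<^sup>2"
proof (induction n arbitrary: k)
  case 0
  show ?case
  proof (cases k)
    case (Suc j)
    then show ?thesis
      by (simp add: binomial_tail_total poisson_tail_def sum.lessThan_Suc_shift del: sum.lessThan_Suc)
  qed (simp add: poisson_tail_def)
next
  case (Suc n)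
  show ?case
  proof (cases k)
    case (Suc j)
    define d where "d i = binomial_tail n i p - poisson_tail i (n * p)" for i
    define s where "s = (1 - p) * poisson_tail (Suc j) (n * p) + p * poisson_tail j (n * p)
      - poisson_tail (Suc j) (n * p + p)"
    have "binomial_tail (Suc n) k p - poisson_tail k (Suc n * p)
        = (1 - p) * d (Suc j) + p * d j + s"
      by (simp add: Suc binomial_tail_Suc_Suc d_def s_def algebra_simps)
    moreover have "\<bar>s\<bar> \<le> p\<^sup>2"
      unfolding s_def using assms by (intro poisson_tail_step) auto
    moreover have "\<bar>(1 - p) * d (Suc j) + p * d j\<bar> \<le> (1 - p) * (n * p\<^sup>2) + p * (n * p\<^sup>2)"
      using Suc.IH assms unfolding d_def
      by (intro order.trans[OF abs_triangle_ineq] add_mono) (auto simp: abs_mult intro!: mult_left_mono)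
    ultimately show ?thesis by (simp add: algebra_simps)
  qed (simp add: poisson_tail_def)
qed

section \<open>Reflection inequalities and the median property\<close>

text \<open>This compares the beta density, including the Jacobian, at the odds
  \<open>k / (l * v)\<close> and \<open>k * v / l\<close>, mirror images about \<open>k / l\<close>
  on the logarithmic scale. The logarithm \<open>h\<close> of the ratio of right to left is, up to
  sign, nondecreasing in the sense that \<open>- h\<close> falls to 0 at
  \<open>v = 1\<close>.\<close>

lemma reflect_odds_le:
  fixes v :: real
  assumes "1 \<le> k" "k \<le> l" "0 \<le> v" "v \<le> 1"
  shows "v ^ l * (l + k * v) ^ (k + l + 1) \<le> v ^ (k - 1) * (k + l * v) ^ (k + l + 1)"
proof (cases "v = 0")
  case False
  with assms have v: "0 < v" by simp
  have pos: "0 < l + k * x" "0 < k + l * x" if "0 < x" for x :: real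
    using that assms by (auto intro!: add_pos_pos)
  define h where "h x = (real l - k + 1) * ln x + (k + l + 1) * (ln (l + k * x) - ln (k + l * x))"
    for x :: real
  have "h v \<le> h 1"
  proof (rule DERIV_nonneg_imp_nondecreasing[OF assms(4)])
    fix x assume "v \<le> x" "x \<le> 1"
    with v have x: "0 < x" by simp
    let ?d = "(real l - k + 1) * (1 / x) + (k + l + 1) * (k / (l + k * x) - l / (k + l * x))"
    have "(h has_real_derivative ?d) (at x)"
      unfolding h_def
    proof (intro DERIV_add DERIV_cmult DERIV_diff)
      show "((\<lambda>x. ln x) has_real_derivative 1 / x) (at x)"
        using x by (auto intro!: derivative_eq_intros)
      show "((\<lambda>x. ln (l + k * x)) has_real_derivative k / (l + k * x)) (at x)"
           "((\<lambda>x. ln (k + l * x)) has_real_derivative l / (k + l * x)) (at x)"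
        using pos[OF x] by (auto intro!: derivative_eq_intros)
    qed
    moreover have "?d \<ge> 0"
    proof -
      let ?q = "(l + k * x) * (k + l * x)"
      have q: "?q > 0" using pos[OF x] by simp
      \<comment> \<open>The square \<open>(1 - x)^2\<close> bounds \<open>?q\<close> from below by
        \<open>(k + l)^2 * x\<close>; inserting this bound leaves at least
        \<open>2 * k * (k + l) * x\<close> in the numerator of \<open>?d\<close>.\<close>
      have "?q - (real k + l)\<^sup>2 * x = k * l * (1 - x)\<^sup>2"
        by (simp add: algebra_simps power2_eq_square)
      then have "(real k + l)\<^sup>2 * x \<le> ?q" by (smt (verit) mult_nonneg_nonneg of_nat_0_le_iff zero_le_power2)
      then have "(real l - k + 1) * ((real k + l)\<^sup>2 * x) \<le> (real l - k + 1) * ?q"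
        using assms by (intro mult_left_mono) auto
      moreover have "(real l - k + 1) * ((real k + l)\<^sup>2 * x) - (real k + l + 1) * (real k + l) * (real l - k) * x
          = (real k + l) * (2 * k) * x"
        by (simp add: algebra_simps power2_eq_square)
      moreover have "(real k + l) * (2 * k) * x \<ge> 0" using x by simp
      ultimately have "0 \<le> (real l - k + 1) * ?q - (real k + l + 1) * (real k + l) * (real l - k) * x"
        by linarith
      moreover have "?d = ((real l - k + 1) * ?q - (real k + l + 1) * (real k + l) * (real l - k) * x) / (x * ?q)"
        using x pos[OF x] by (simp add: divide_simps) (simp add: algebra_simps)
      ultimately show ?thesis using x q by simp
    qed
    ultimately show "\<exists>y. (h has_real_derivative y) (at x) \<and> 0 \<le> y" by blast
  qed
  then have "h v \<le> 0" by (simp add: h_def add.commute)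
  then have "l * ln v + (k + l + 1) * ln (l + k * v) \<le> (k - 1) * ln v + (k + l + 1) * ln (k + l * v)"
    using assms by (simp add: h_def of_nat_diff algebra_simps)
  then have "ln (v ^ l * (l + k * v) ^ (k + l + 1)) \<le> ln (v ^ (k - 1) * (k + l * v) ^ (k + l + 1))"
    using v pos[OF v] by (simp only: ln_mult_pos ln_realpow zero_less_power)
  then show ?thesis
    using v pos[OF v] by (subst (asm) ln_le_cancel_iff) (auto intro!: mult_pos_pos)
qed (use assms in \<open>simp add: power_0_left\<close>)

text \<open>With \<open>n = k + l\<close>, this compares the beta density at
  \<open>(k + u) / n\<close> and \<open>(k - u) / n\<close>, the powers of \<open>n\<close>
  cancelled. The logarithm \<open>h\<close> of the ratio of left to right vanishes at 0 and is
  nonincreasing. At \<open>u = l\<close>, where the logarithm breaks down, the left side is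
  0.\<close>

lemma reflect_le:
  fixes u :: real
  assumes "1 \<le> l" "l \<le> k" "0 \<le> u" "u \<le> l"
  shows "(k + u) ^ (k - 1) * (l - u) ^ l \<le> (k - u) ^ (k - 1) * (l + u) ^ l"
proof (cases "u = l")
  case False
  with assms have u: "u < l" by simp
  have pos: "0 < k + x" "0 < k - x" "0 < l + x" "0 < l - x" if "0 \<le> x" "x \<le> u" for x :: real
    using that assms u by auto
  define h where "h x = (real k - 1) * (ln (k + x) - ln (k - x)) + l * (ln (l - x) - ln (l + x))"
    for x :: real
  have "h u \<le> h 0"
  proof (rule DERIV_nonpos_imp_nonincreasing[OF assms(3)])
    fix x assume x: "0 \<le> x" "x \<le> u"
    let ?d = "(real k - 1) * (1 / (k + x) + 1 / (k - x)) - l * (1 / (l - x) + 1 / (l + x))"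
    have "(h has_real_derivative
        (real k - 1) * (1 / (k + x) - - 1 / (k - x)) + l * (- 1 / (l - x) - 1 / (l + x))) (at x)"
      unfolding h_def
    proof (intro DERIV_add DERIV_cmult DERIV_diff)
      show "((\<lambda>x. ln (k + x)) has_real_derivative 1 / (k + x)) (at x)"
           "((\<lambda>x. ln (k - x)) has_real_derivative - 1 / (k - x)) (at x)"
           "((\<lambda>x. ln (l + x)) has_real_derivative 1 / (l + x)) (at x)"
           "((\<lambda>x. ln (l - x)) has_real_derivative - 1 / (l - x)) (at x)"
        using pos[OF x] by (auto intro!: derivative_eq_intros)
    qed
    also have "(real k - 1) * (1 / (k + x) - - 1 / (k - x)) + l * (- 1 / (l - x) - 1 / (l + x)) = ?d"
      by (simp add: right_diff_distrib distrib_left)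
    finally have "(h has_real_derivative ?d) (at x)" .
    moreover have "?d \<le> 0"
    proof -
      \<comment> \<open>The numerator below equals
        \<open>- k * (l^2 - x^2) - (k^2 - l^2) * x^2\<close>, and both terms are nonpositive because
        \<open>x \<le> l \<le> k\<close>.\<close>
      have "x\<^sup>2 \<le> (real l)\<^sup>2" using x u by (intro power_mono) auto
      then have "k * x\<^sup>2 \<le> k * (real l)\<^sup>2" by (intro mult_left_mono) auto
      moreover have "(real l)\<^sup>2 * x\<^sup>2 \<le> (real k)\<^sup>2 * x\<^sup>2"
        using assms by (intro mult_right_mono power_mono) auto
      ultimately have "(real k - 1) * k * ((real l)\<^sup>2 - x\<^sup>2) - (real l)\<^sup>2 * ((real k)\<^sup>2 - x\<^sup>2) \<le> 0"
        by (simp add: algebra_simps power2_eq_square)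
      moreover have "?d = 2 * ((real k - 1) * k * ((real l)\<^sup>2 - x\<^sup>2) - (real l)\<^sup>2 * ((real k)\<^sup>2 - x\<^sup>2))
          / (((k + x) * (k - x)) * ((l - x) * (l + x)))"
      proof -
        have "1 / (k + x) + 1 / (k - x) = 2 * k / ((k + x) * (k - x))"
             "1 / (l - x) + 1 / (l + x) = 2 * l / ((l - x) * (l + x))"
          using pos[OF x] by (simp_all add: divide_simps)
        then have "?d = (real k - 1) * (2 * k / ((k + x) * (k - x))) - l * (2 * l / ((l - x) * (l + x)))"
          by simp
        also have "\<dots> = ((real k - 1) * (2 * k) * ((l - x) * (l + x)) - l * (2 * l) * ((k + x) * (k - x)))
            / (((k + x) * (k - x)) * ((l - x) * (l + x)))"
          using pos[OF x] by (simp add: diff_divide_distrib)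
        also have "(real k - 1) * (2 * k) * ((l - x) * (l + x)) - l * (2 * l) * ((k + x) * (k - x))
            = 2 * ((real k - 1) * k * ((real l)\<^sup>2 - x\<^sup>2) - (real l)\<^sup>2 * ((real k)\<^sup>2 - x\<^sup>2))"
          by (simp add: algebra_simps power2_eq_square)
        finally show ?thesis .
      qed
      moreover have "0 < ((k + x) * (k - x)) * ((l - x) * (l + x))"
        using pos[OF x] by simp
      ultimately show ?thesis by (simp add: divide_nonpos_pos)
    qed
    ultimately show "\<exists>y. (h has_real_derivative y) (at x) \<and> y \<le> 0" by blast
  qed
  then have "h u \<le> 0" by (simp add: h_def)
  then have "(k - 1) * ln (k + u) + l * ln (l - u) \<le> (k - 1) * ln (k - u) + l * ln (l + u)"
    using assms by (simp add: h_def of_nat_diff algebra_simps)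
  then have "ln ((k + u) ^ (k - 1) * (l - u) ^ l) \<le> ln ((k - u) ^ (k - 1) * (l + u) ^ l)"
    using pos[of u] assms(3) by (simp only: ln_mult_pos ln_realpow zero_less_power)
  then show ?thesis
    using pos[of u] assms(3) by (subst (asm) ln_le_cancel_iff) (auto intro!: mult_pos_pos)
qed (use assms in \<open>simp add: power_0_left\<close>)

lemma binomial_tail_mean_le_half:
  assumes "1 \<le> k" "1 \<le> l"
  shows "binomial_tail (k + l) k (real k / real (k + l)) \<le> 1 / 2"
proof -
  define n where "n = real (k + l)"
  define W where "W = binomial_tail (k + l) k"
  define c :: real where "c = fact (k + l) / (fact (k - 1) * fact l)"
  define f where "f x = x ^ (k - 1) * (1 - x) ^ l" for x :: real
  have n: "n > 0" using assms by (simp add: n_def)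
  have c: "c > 0" by (simp add: c_def)
  have W: "(W has_real_derivative - (c * f x)) (at x)" for x
    unfolding W_def c_def f_def using has_field_derivative_binomial_tail[OF refl assms(1)] .
  have W1: "W 1 = 0" unfolding W_def by (simp add: binomial_tail_at_1)
  have Wle: "W x \<le> 1" if "0 \<le> x" "x \<le> 1" for x
    unfolding W_def using that by (rule binomial_tail_le_1)
  have "2 * W (k / n) \<le> 1"
  proof (cases "k \<le> l")
    case True
    \<comment> \<open>The two arguments have odds \<open>k / (l * v)\<close> and
      \<open>k * v / l\<close>. Both are \<open>k / n\<close> at \<open>v = 1\<close>; at
      \<open>v = 0\<close> they are the endpoints 1 and 0.\<close>
    define D where "D v = W (k / (k + l * v)) + W (k * v / (l + k * v))" for v :: real
    have "D 1 \<le> D 0"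
    proof (rule DERIV_nonpos_imp_nonincreasing[of 0 1 D])
      fix v :: real assume v: "0 \<le> v" "v \<le> 1"
      define a where "a = k + l * v"
      define b where "b = l + k * v"
      have ab: "a > 0" "b > 0"
        using assms v by (auto simp: a_def b_def intro!: add_pos_nonneg)
      have "((\<lambda>v. k / (k + l * v)) has_real_derivative - (k * l / a\<^sup>2)) (at v)"
        using ab unfolding a_def
        by (auto intro!: derivative_eq_intros simp: power2_eq_square)
      moreover have "((\<lambda>v. k * v / (l + k * v)) has_real_derivative k * l / b\<^sup>2) (at v)"
        using ab unfolding b_def
        by (auto intro!: derivative_eq_intros simp: power2_eq_square algebra_simps)
      ultimately have "(D has_real_derivative
          - (c * f (k / a)) * - (k * l / a\<^sup>2) + - (c * f (k * v / b)) * (k * l / b\<^sup>2)) (at v)"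
        unfolding D_def a_def b_def by (intro DERIV_add DERIV_chain2[OF W])
      moreover have "f (k / a) / a\<^sup>2 \<le> f (k * v / b) / b\<^sup>2"
      proof -
        \<comment> \<open>The exponents \<open>k - 1\<close> and \<open>l\<close> come from the
          density, the 2 from the Jacobian.\<close>
        have e: "k + l + 1 = (k - 1) + l + 2" using assms by simp
        have "1 - k / a = l * v / a" "1 - k * v / b = l / b"
          using ab by (simp_all add: field_simps) (simp_all add: a_def b_def)
        then have "f (k / a) / a\<^sup>2 = k ^ (k - 1) * l ^ l * (v ^ l / a ^ (k + l + 1))"
            "f (k * v / b) / b\<^sup>2 = k ^ (k - 1) * l ^ l * (v ^ (k - 1) / b ^ (k + l + 1))"
          unfolding f_def e power_add by (simp_all add: power_divide power_mult_distrib)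
        moreover have "v ^ l / a ^ (k + l + 1) \<le> v ^ (k - 1) / b ^ (k + l + 1)"
          using reflect_odds_le[OF assms(1) True v] ab
          by (simp add: a_def b_def divide_simps mult.commute)
        ultimately show ?thesis by (simp only:) (intro mult_left_mono, auto)
      qed
      then have "c * (k * l) * (f (k / a) / a\<^sup>2) \<le> c * (k * l) * (f (k * v / b) / b\<^sup>2)"
        using c by (intro mult_left_mono) auto
      then have "- (c * f (k / a)) * - (k * l / a\<^sup>2) + - (c * f (k * v / b)) * (k * l / b\<^sup>2) \<le> 0"
        by (simp add: algebra_simps)
      ultimately show "\<exists>y. (D has_real_derivative y) (at v) \<and> y \<le> 0" by blast
    qed simp
    moreover have "D 1 = 2 * W (k / n)" by (simp add: D_def n_def add.commute)
    moreover have "D 0 \<le> 1" using assms Wle[of 0] by (simp add: D_def W1)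
    ultimately show ?thesis by simp
  next
    case False
    then have kl: "l \<le> k" by simp
    \<comment> \<open>At \<open>u = l\<close> the right point reaches 1, where \<open>W\<close>
      vanishes; the left one is \<open>(k - l) / n\<close>, still nonnegative because
      \<open>l \<le> k\<close>.\<close>
    define D where "D u = W ((k + u) / n) + W ((k - u) / n)" for u :: real
    have "D 0 \<le> D l"
    proof (rule DERIV_nonneg_imp_nondecreasing[of 0 l D])
      fix u assume u: "0 \<le> u" "u \<le> real l"
      have "((\<lambda>u. (k + u) / n) has_real_derivative 1 / n) (at u)"
           "((\<lambda>u. (k - u) / n) has_real_derivative - (1 / n)) (at u)"
        using n by (auto intro!: derivative_eq_intros)
      then have "(D has_real_derivative
          - (c * f ((k + u) / n)) * (1 / n) + - (c * f ((k - u) / n)) * - (1 / n)) (at u)"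
        unfolding D_def by (intro DERIV_add DERIV_chain2[OF W])
      moreover have "f ((k + u) / n) \<le> f ((k - u) / n)"
      proof -
        have "1 - (k + u) / n = (l - u) / n" "1 - (k - u) / n = (l + u) / n"
          using n by (simp_all add: field_simps) (simp_all add: n_def)
        then show ?thesis
          using reflect_le[OF assms(2) kl u] n
          by (simp add: f_def power_divide divide_right_mono)
      qed
      then have "0 \<le> c / n * (f ((k - u) / n) - f ((k + u) / n))"
        using c n by simp
      then have "0 \<le> - (c * f ((k + u) / n)) * (1 / n) + - (c * f ((k - u) / n)) * - (1 / n)"
        by (simp add: algebra_simps)
      ultimately show "\<exists>y. (D has_real_derivative y) (at u) \<and> 0 \<le> y" by blast
    qed simp
    moreover have "D 0 = 2 * W (k / n)" by (simp add: D_def)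
    moreover have "(k + real l) / n = 1" using n by (simp add: n_def)
    moreover have "W ((k - real l) / n) \<le> 1"
      using kl n by (intro Wle) (auto simp: n_def)
    ultimately show ?thesis by (simp add: D_def W1)
  qed
  then show ?thesis by (simp add: W_def n_def)
qed

section \<open>Bounds on the central probability\<close>

text \<open>Successive bases differ by the factor \<open>r = 1 - 1 / (n + 1)^2\<close>, and
  Bernoulli's inequality gives \<open>r ^ Suc n \<ge> 1 / y\<close>. At \<open>n = 0\<close> the
  convention \<open>1 / 0 = 0\<close> is harmless, since the power is 1.\<close>

lemma incseq_euler: "incseq (\<lambda>n. (1 + 1 / real n) ^ n)"
proof (rule incseq_SucI)
  fix n
  show "(1 + 1 / real n) ^ n \<le> (1 + 1 / real (Suc n)) ^ Suc n"
  proof (cases "n = 0")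
    case False
    define y where "y = 1 + 1 / real n"
    define r where "r = 1 - 1 / (real n + 1)\<^sup>2"
    have y: "y > 0" by (simp add: y_def add_pos_nonneg)
    have eq: "1 + 1 / real (Suc n) = y * r"
      using False by (simp add: y_def r_def divide_simps) (simp add: algebra_simps power2_eq_square)
    have "1 / (real n + 1)\<^sup>2 \<le> 1" by (simp add: divide_simps)
    then have "1 + real (Suc n) * (- (1 / (real n + 1)\<^sup>2)) \<le> (1 + - (1 / (real n + 1)\<^sup>2)) ^ Suc n"
      by (intro Bernoulli_inequality) simp
    also have "1 + real (Suc n) * (- (1 / (real n + 1)\<^sup>2)) = 1 / y"
      using False by (simp add: y_def divide_simps) (simp add: algebra_simps power2_eq_square)
    finally have "1 \<le> y * r ^ Suc n"
      using y by (simp add: r_def pos_divide_le_eq mult.commute del: power_Suc)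
    then have "y ^ n * 1 \<le> y ^ n * (y * r ^ Suc n)"
      using y by (intro mult_left_mono) auto
    also have "\<dots> = (1 + 1 / real (Suc n)) ^ Suc n"
      unfolding eq by (simp add: power_mult_distrib)
    finally show ?thesis by (simp add: y_def)
  qed simp
qed

text \<open>The square of the left side times \<open>2 * k + 1\<close> starts at 1 and is multiplied
  in each step by \<open>(2 * k + 1) * (2 * k + 3) / (2 * k + 2)^2\<close>, which is at most
  1.\<close>

lemma central_binomial_upper_bound: "real (2 * k choose k) / 4 ^ k \<le> 1 / sqrt (2 * k + 1)"
proof -
  have "(real (2 * k choose k) / 4 ^ k)\<^sup>2 * (2 * k + 1) \<le> 1"
  proof (induction k)
    case (Suc k)
    define q where "q = real (2 * k choose k) / 4 ^ k"
    have "real (2 * Suc k choose Suc k) = real (2 * k choose k) * (2 * (2 * k + 1) / (k + 1))"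
    proof -
      have C: "real (2 * m choose m) = fact (2 * m) / (fact m * fact m)" for m
        using binomial_fact[of m "2 * m", where 'a = real] by (simp add: mult_2)
      show ?thesis
        unfolding C by (simp add: divide_simps) (simp add: algebra_simps)
    qed
    then have step: "real (2 * Suc k choose Suc k) / 4 ^ Suc k = q * ((2 * k + 1) / (2 * k + 2))"
      by (simp add: q_def divide_simps) (simp add: algebra_simps)
    have "(q * ((2 * k + 1) / (2 * k + 2)))\<^sup>2 * (2 * Suc k + 1)
        = (q\<^sup>2 * (2 * k + 1)) * ((2 * real k + 1) * (2 * real k + 3) / (2 * real k + 2)\<^sup>2)"
      by (simp add: power2_eq_square) (simp add: algebra_simps)
    also have "\<dots> \<le> 1 * 1"
    proof (rule mult_mono)
      have "(2 * real k + 1) * (2 * real k + 3) \<le> (2 * real k + 2)\<^sup>2"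
        by (simp add: power2_eq_square algebra_simps)
      then show "(2 * real k + 1) * (2 * real k + 3) / (2 * real k + 2)\<^sup>2 \<le> 1"
        by (intro divide_le_eq_1[THEN iffD2]) (auto simp: zero_less_power2)
    qed (use Suc.IH in \<open>auto simp: q_def\<close>)
    finally show ?case unfolding step by simp
  qed simp
  then have "(real (2 * k choose k) / 4 ^ k)\<^sup>2 \<le> 1 / (2 * k + 1)"
    by (simp add: pos_le_divide_eq)
  then have "sqrt ((real (2 * k choose k) / 4 ^ k)\<^sup>2) \<le> sqrt (1 / (2 * k + 1))"
    by (rule real_sqrt_le_mono)
  then show ?thesis by (simp add: real_sqrt_divide)
qed

text \<open>The ratio of the left side to the right is \<open>a l / a n\<close> with
  \<open>a m = (1 + 1 / m) ^ m\<close>; as \<open>l \<le> n\<close> and \<open>a\<close> increases,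
  it is at most 1.\<close>

lemma Bernstein_mean_decreasing:
  assumes "1 \<le> k" "1 \<le> l"
  shows "Bernstein (k + Suc l) k (k / real (k + Suc l)) \<le> Bernstein (k + l) k (k / real (k + l))"
proof -
  define n where "n = k + l"
  define a where "a m = (1 + 1 / real m) ^ m" for m
  have n: "n > 0" using assms by (simp add: n_def)
  have B: "Bernstein (k + j) k (k / real (k + j))
      = fact (k + j) / (fact k * fact j) * k ^ k * j ^ j / real (k + j) ^ (k + j)" if "1 \<le> j" for j
  proof -
    have "1 - k / real (k + j) = j / real (k + j)"
      using that by (simp add: field_simps)
    then show ?thesis
      by (simp add: Bernstein_def binomial_fact power_divide power_add)
  qed
  have a: "a m = (real m + 1) ^ m / real m ^ m" if "0 < m" for m
    using that by (simp add: a_def flip: power_divide) (simp add: add_divide_distrib)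
  have "a l \<le> a n"
    using incseq_euler unfolding a_def n_def by (rule incseqD) simp
  have an: "a n > 0" unfolding a_def by (intro zero_less_power add_pos_nonneg) auto
  have "Bernstein (k + Suc l) k (k / real (k + Suc l)) * a n = Bernstein (k + l) k (k / real (k + l)) * a l"
  proof -
    have nl: "real n + 1 \<noteq> 0" "real l + 1 \<noteq> 0" "real n \<noteq> 0" "real l \<noteq> 0"
      using n assms by (auto simp: add_eq_0_iff_both_eq_0 simp flip: of_nat_Suc)
    have "Bernstein (k + Suc l) k (k / real (k + Suc l))
        = (real n + 1) * fact n / (fact k * ((real l + 1) * fact l)) * k ^ k * ((real l + 1) * (real l + 1) ^ l)
          / ((real n + 1) * (real n + 1) ^ n)"
      using B[of "Suc l"] by (simp add: n_def add_ac)
    also have "\<dots> = fact n / (fact k * fact l) * k ^ k * (real l + 1) ^ l / (real n + 1) ^ n"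
      using nl by simp
    finally show ?thesis
      using B[OF assms(2)] nl n assms by (simp add: a flip: n_def)
  qed
  also have "\<dots> \<le> Bernstein (k + l) k (k / real (k + l)) * a n"
    using \<open>a l \<le> a n\<close> by (intro mult_left_mono Bernstein_nonneg) (auto simp: divide_simps)
  finally show ?thesis using an by simp
qed

text \<open>Reflection reduces to \<open>k \<le> l\<close>. Raising \<open>l\<close> from
  \<open>k\<close> only lowers the probability, and at \<open>l = k\<close> it is a central binomial
  coefficient over \<open>4 ^ k\<close>.\<close>

lemma Bernstein_mean_le:
  assumes "1 \<le> k" "1 \<le> l"
  shows "Bernstein (k + l) k (k / real (k + l)) \<le> 1 / sqrt (min k l)"
proof -
  have *: "Bernstein (k + l) k (k / real (k + l)) \<le> 1 / sqrt k" if "1 \<le> k" "k \<le> l" for k l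
    using that(2)
  proof (induction l rule: dec_induct)
    case base
    have "real k / real (k + k) = 1 / 2" using that by simp
    then have "Bernstein (k + k) k (k / real (k + k)) = real (k + k choose k) * (1 / 2) ^ k * (1 - 1 / 2) ^ (k + k - k)"
      by (simp only: Bernstein_def)
    also have "\<dots> = real (2 * k choose k) / 4 ^ k"
      by (simp add: power_divide flip: mult_2 power_mult_distrib)
    also have "\<dots> \<le> 1 / sqrt (2 * k + 1)"
      by (rule central_binomial_upper_bound)
    also have "\<dots> \<le> 1 / sqrt k"
      using that by (intro divide_left_mono) auto
    finally show ?case .
  next
    case (step l)
    then show ?case using Bernstein_mean_decreasing[of k l] that by simp
  qed
  show ?thesis
  proof (cases "k \<le> l")
    case True
    then show ?thesis using *[OF assms(1)] by (simp add: min_def)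
  next
    case False
    have "1 - k / real (k + l) = l / real (k + l)"
      using assms by (simp add: field_simps)
    then have "Bernstein (k + l) k (k / real (k + l)) = Bernstein (l + k) l (l / real (l + k))"
      using Bernstein_reflect[of k "k + l" "k / real (k + l)"] by (simp add: add.commute)
    then show ?thesis using *[OF assms(2), of k] False by (simp add: min_def)
  qed
qed

section \<open>The three estimates, with constant 1\<close>

theorem theorem1:
  shows "\<exists>A::real. A > 0 \<and> (\<forall>k l :: nat. k \<ge> 1 \<and> l \<ge> 1 \<longrightarrow>
    \<bar>P k l - exp (- real k) * (\<Sum>\<nu> = 0..k - 1. real k ^ \<nu> / fact \<nu>)\<bar>
      \<le> A * (real k ^ 2 / real l) \<and>
    \<bar>P k l - (1 - exp (- real l) * (\<Sum>\<nu> = 0..l. real l ^ \<nu> / fact \<nu>))\<bar>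
      \<le> A * (real l ^ 2 / real k) \<and>
    \<bar>P k l - 1 / 2\<bar> \<le> A / sqrt (real (min k l)))"
proof (intro exI[of _ 1] conjI allI impI; (elim conjE)?)
  fix k l :: nat assume kl: "k \<ge> 1" "l \<ge> 1"
  define n where "n = k + l"
  define p where "p = real k / real n"
  define q where "q = real l / real n"
  have n: "n > 0" and pq: "0 \<le> p" "p \<le> 1" "0 \<le> q" "q \<le> 1" "1 - p = q" "n * p = k" "n * q = l"
    using kl by (auto simp: n_def p_def q_def field_simps)
  have P: "P k l = binomial_tail n k p"
    using P_eq_binomial_tail[OF kl] by (simp add: n_def p_def)
  \<comment> \<open>In terms of failures, which have mean \<open>l\<close>, fewer than
    \<open>k\<close> successes means more than \<open>l\<close> failures.\<close>
  have Q: "P k l = 1 - binomial_tail n (Suc l) q"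
    using binomial_tail_reflect[of k l n p] by (simp add: P pq n_def)

  have np: "n * p\<^sup>2 = (real k)\<^sup>2 / n" "n * q\<^sup>2 = (real l)\<^sup>2 / n"
    using n by (simp_all add: p_def q_def power2_eq_square)
  have "\<bar>P k l - poisson_tail k k\<bar> \<le> (real k)\<^sup>2 / n"
    using binomial_tail_poisson[OF pq(1,2), of n k] by (simp only: P pq np)
  also have "\<dots> \<le> (real k)\<^sup>2 / l"
    using kl by (intro divide_left_mono) (auto simp: n_def)
  finally show "\<bar>P k l - exp (- real k) * (\<Sum>\<nu> = 0..k - 1. real k ^ \<nu> / fact \<nu>)\<bar> \<le> 1 * (real k ^ 2 / real l)"
    using kl by (cases k) (simp_all add: poisson_tail_def atLeast0AtMost lessThan_Suc_atMost del: sum.lessThan_Suc)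

  have "\<bar>P k l - (1 - poisson_tail (Suc l) l)\<bar> = \<bar>binomial_tail n (Suc l) q - poisson_tail (Suc l) l\<bar>"
    by (simp add: Q)
  also have "\<dots> \<le> (real l)\<^sup>2 / n"
    using binomial_tail_poisson[OF pq(3,4), of n "Suc l"] by (simp only: pq np)
  also have "\<dots> \<le> (real l)\<^sup>2 / k"
    using kl by (intro divide_left_mono) (auto simp: n_def)
  finally show "\<bar>P k l - (1 - exp (- real l) * (\<Sum>\<nu> = 0..l. real l ^ \<nu> / fact \<nu>))\<bar> \<le> 1 * (real l ^ 2 / real k)"
    by (simp add: poisson_tail_def atLeast0AtMost lessThan_Suc_atMost del: sum.lessThan_Suc)

  \<comment> \<open>The upper bound is the median property for successes. For the lower bound, the
    same property for failures bounds the chance of fewer than \<open>l\<close> failures by 1/2, so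
    \<open>P k l\<close> misses 1/2 by at most the chance of exactly \<open>l\<close>
    failures.\<close>
  have "P k l \<le> 1 / 2"
    using binomial_tail_mean_le_half[OF kl] by (simp add: P n_def p_def)
  moreover have "binomial_tail n l q \<le> 1 / 2"
    using binomial_tail_mean_le_half[OF kl(2,1)] by (simp add: n_def q_def add.commute)
  moreover have "Bernstein n l q \<le> 1 / sqrt (min k l)"
    using Bernstein_mean_le[OF kl(2,1)] by (simp add: n_def q_def add.commute min.commute)
  moreover have "P k l = 1 - (binomial_tail n l q + Bernstein n l q)"
    by (simp add: Q binomial_tail_def)
  ultimately show "\<bar>P k l - 1 / 2\<bar> \<le> 1 / sqrt (real (min k l))"
    by linarith
qed simp

end
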